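(* Let $\mathcal{U}$ be an uncertainty set satisfying Assumption 1, let $\beta>0$ and $v\in\mathcal{U}$, and suppose $\hat{\mathcal{U}}=\beta\cdot\mathrm{conv}(e_1,\dots,e_m,v)$ dominates $\mathcal{U}$. Let $(\hat x,\hat y(\hat h))$, $\hat h\in\hat{\mathcal{U}}$, be an optimal solution of $\Pi_{AR}(\hat{\mathcal{U}})$. Then the piecewise affine solution $$x=2\hat x,\qquad y(h)=\frac1\beta\sum_{i=1}^m(h_i-\beta v_i)^+\,\hat y(\beta e_i)+\hat y(\beta v)\quad\text{for all }h\in\mathcal{U},$$ is feasible for $\Pi_{AR}(\mathcal{U})$ and gives a $2\beta$-approximation for $\Pi_{AR}(\mathcal{U})$.
   Context: Vector inequalities are componentwise; $e_i$ is the $i$-th standard basis vector of $\mathbb{R}^m$; $(a)^+=\max(a,0)$; $\mathrm{conv}$ denotes convex hull. Two-stage adjustable robust problem $\Pi_{AR}(\mathcal{S})$: the data are $A\in\mathbb{R}_+^{m\times n}$, $B\in\mathbb{R}^{m\times n}$, $c,d\in\mathbb{R}^n_+$. For a set $\mathcal{S}\subseteq\mathbb{R}^m_+$, a feasible solution is a pair $(x,y(\cdot))$ with $x\in\mathbb{R}^n_+$, $y:\mathcal{S}\to\mathbb{R}^n_+$ and $Ax+By(h)\ge h$ for all $h\in\mathcal{S}$; the optimal value $z_{AR}(\mathcal{S})$ is the minimum (infimum) over feasible solutions of the worst-case cost $c^Tx+\max_{h\in\mathcal{S}}d^Ty(h)$ (max read as supremum; value $+\infty$ if infeasible). An optimal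 solution is a feasible solution whose worst-case cost equals $z_{AR}(\mathcal{S})<\infty$. A feasible solution $(x,y(\cdot))$ of $\Pi_{AR}(\mathcal{U})$ gives an $\alpha$-approximation if $c^Tx+d^Ty(h)\le\alpha\cdot z_{AR}(\mathcal{U})$ for all $h\in\mathcal{U}$. Assumption 1 on $\mathcal{U}$: $\mathcal{U}\subseteq[0,1]^m$ is convex, full-dimensional, $e_i\in\mathcal{U}$ for all $i=1,\dots,m$, and down-monotone, i.e. $h\in\mathcal{U}$ and $0\le h'\le h$ imply $h'\in\mathcal{U}$. Domination: $\hat{\mathcal{U}}\subseteq\mathbb{R}^m_+$ dominates $\mathcal{U}$ if for every $h\in\mathcal{U}$ there is $\hat h\in\hat{\mathcal{U}}$ with $\hat h\ge h$. *)

theory Defs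
  imports "HOL-Analysis.Analysis"
begin

text \<open>
  The order on \<^typ>\<open>real^'n\<close> and on \<^typ>\<open>real^'n^'m\<close> is the library's componentwise one.
  A recourse policy is a total function of which only the values on the scenario set matter.
\<close>

definition ar_feasible ::
    "real^'n^'m \<Rightarrow> real^'n^'m \<Rightarrow> (real^'m) set \<Rightarrow> real^'n \<Rightarrow> (real^'m \<Rightarrow> real^'n) \<Rightarrow> bool" where
  "ar_feasible A B S x y \<longleftrightarrow>
     0 \<le> x \<and> (\<forall>h\<in>S. 0 \<le> y h) \<and> (\<forall>h\<in>S. A *v x + B *v y h \<ge> h)"

definition ar_cost ::
    "real^'n \<Rightarrow> real^'n \<Rightarrow> (real^'m) set \<Rightarrow> real^'n \<Rightarrow> (real^'m \<Rightarrow> real^'n) \<Rightarrow> ereal" where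
  "ar_cost c d S x y = ereal (c \<bullet> x) + (SUP h\<in>S. ereal (d \<bullet> y h))"

text \<open>If there is no feasible solution, the infimum is over the empty set and equals \<open>\<infinity>\<close>.\<close>

definition z_AR ::
    "real^'n^'m \<Rightarrow> real^'n^'m \<Rightarrow> real^'n \<Rightarrow> real^'n \<Rightarrow> (real^'m) set \<Rightarrow> ereal" where
  "z_AR A B c d S = Inf {ar_cost c d S x y | x y. ar_feasible A B S x y}"

definition ar_optimal ::
    "real^'n^'m \<Rightarrow> real^'n^'m \<Rightarrow> real^'n \<Rightarrow> real^'n \<Rightarrow> (real^'m) set \<Rightarrow>
     real^'n \<Rightarrow> (real^'m \<Rightarrow> real^'n) \<Rightarrow> bool" where
  "ar_optimal A B c d S x y \<longleftrightarrow>
     ar_feasible A B S x y \<and> ar_cost c d S x y = z_AR A B c d S \<and> z_AR A B c d S < \<infinity>"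

definition ar_approximation ::
    "real^'n^'m \<Rightarrow> real^'n^'m \<Rightarrow> real^'n \<Rightarrow> real^'n \<Rightarrow> (real^'m) set \<Rightarrow>
     real \<Rightarrow> real^'n \<Rightarrow> (real^'m \<Rightarrow> real^'n) \<Rightarrow> bool" where
  "ar_approximation A B c d U \<alpha> x y \<longleftrightarrow>
     ar_feasible A B U x y \<and>
     (\<forall>h\<in>U. ereal (c \<bullet> x + d \<bullet> y h) \<le> ereal \<alpha> * z_AR A B c d U)"

definition assumption_1 :: "(real^'m) set \<Rightarrow> bool" where
  "assumption_1 U \<longleftrightarrow>
     U \<subseteq> {h. \<forall>i. 0 \<le> h $ i \<and> h $ i \<le> 1} \<and>
     convex U \<and>
     aff_dim U = int CARD('m) \<and>
     (\<forall>i. axis i 1 \<in> U) \<and>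
     (\<forall>h\<in>U. \<forall>h'. 0 \<le> h' \<and> h' \<le> h \<longrightarrow> h' \<in> U)"

definition dominates :: "(real^'m) set \<Rightarrow> (real^'m) set \<Rightarrow> bool" where
  "dominates Uhat U \<longleftrightarrow> (\<forall>h\<in>U. \<exists>hhat\<in>Uhat. hhat \<ge> h)"

end

theory Submission
  imports Defs
begin

text \<open>
  Every point \<open>\<beta> g\<close> of the dominating set satisfies \<open>(\<Sum>i. (g\<^sub>i - v\<^sub>i)\<^sup>+) \<le> 1\<close>, because this convex
  condition holds at the vertices. Hence the weights \<open>(h\<^sub>i - \<beta> v\<^sub>i)\<^sup>+ / \<beta>\<close> sum to at most 1, and
  the proposed policy combines the covering constraints at \<open>\<beta> e\<^sub>i\<close> and \<open>\<beta> v\<close> with total weight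
  at most 2. This gives feasibility and the bound \<open>2 z_AR Uhat\<close> on the cost. Since \<open>Uhat\<close> is
  contained in \<open>\<beta> U\<close>, scaling solutions by \<open>\<beta>\<close> gives \<open>z_AR Uhat \<le> \<beta> z_AR U\<close>.
\<close>

text \<open>Reduces worst-case bounds to bounds scenario by scenario, the form used in
  \<open>ar_approximation\<close>. Since the supremum may be infinite, a finite \<open>M\<close>
  lets the real \<open>c \<bullet> x\<close> change sides, and the infinite values are treated
  apart.\<close>

lemma ar_cost_le_iff:
  assumes "S \<noteq> {}"
  shows "ar_cost c d S x y \<le> M \<longleftrightarrow> (\<forall>h\<in>S. ereal (c \<bullet> x + d \<bullet> y h) \<le> M)"
proof (cases M)
  case (real r)
  have "ar_cost c d S x y \<le> M \<longleftrightarrow> (SUP h\<in>S. ereal (d \<bullet> y h)) \<le> ereal (r - c \<bullet> x)"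
    unfolding ar_cost_def real
    by (cases "SUP h\<in>S. ereal (d \<bullet> y h)") auto
  then show ?thesis
    by (auto simp: SUP_le_iff real algebra_simps)
next
  case PInf
  then show ?thesis by simp
next
  \<comment> \<open>Both sides are false: a single scenario already keeps the supremum above
    -\<infinity>.\<close>
  case MInf
  obtain h where "h \<in> S" using assms by auto
  then have "ereal (d \<bullet> y h) \<le> (SUP h\<in>S. ereal (d \<bullet> y h))"
    by (rule SUP_upper)
  then have "ar_cost c d S x y \<noteq> -\<infinity>"
    unfolding ar_cost_def by (cases "SUP h\<in>S. ereal (d \<bullet> y h)") auto
  then show ?thesis using MInf \<open>h \<in> S\<close> by auto
qed

text \<open>The constraints are positively homogeneous. The policy divides its argument by \<beta>,
  so at \<open>\<beta> *\<^sub>R g\<close> it returns \<beta> times the old decision for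
  \<open>g\<close>; passing to \<open>G\<close> only drops constraints.\<close>

lemma ar_feasible_scale:
  assumes feas: "ar_feasible A B U x y" and "\<beta> > 0" and "G \<subseteq> U"
  shows "ar_feasible A B ((\<lambda>h. \<beta> *\<^sub>R h) ` G) (\<beta> *\<^sub>R x) (\<lambda>h. \<beta> *\<^sub>R y ((1 / \<beta>) *\<^sub>R h))"
proof -
  have "\<beta> *\<^sub>R g \<le> A *v (\<beta> *\<^sub>R x) + B *v (\<beta> *\<^sub>R y g)" if "g \<in> G" for g
  proof -
    have "g \<le> A *v x + B *v y g"
      using feas \<open>G \<subseteq> U\<close> that unfolding ar_feasible_def by auto
    then have "\<beta> *\<^sub>R g \<le> \<beta> *\<^sub>R (A *v x + B *v y g)"
      using \<open>\<beta> > 0\<close> by (intro scaleR_left_mono) auto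
    then show ?thesis
      by (simp add: matrix_vector_mult_scaleR scaleR_add_right)
  qed
  moreover have "0 \<le> \<beta> *\<^sub>R x" "\<And>g. g \<in> G \<Longrightarrow> 0 \<le> \<beta> *\<^sub>R y g"
    using feas \<open>\<beta> > 0\<close> \<open>G \<subseteq> U\<close> unfolding ar_feasible_def
    by (auto intro!: scaleR_nonneg_nonneg)
  ultimately show ?thesis
    using \<open>\<beta> > 0\<close> unfolding ar_feasible_def by auto
qed

lemma z_AR_scale_le:
  assumes "\<beta> > 0" and "G \<subseteq> U" and "G \<noteq> {}"
  shows "z_AR A B c d ((\<lambda>h. \<beta> *\<^sub>R h) ` G) \<le> ereal \<beta> * z_AR A B c d U"
proof -
  let ?S = "(\<lambda>h. \<beta> *\<^sub>R h) ` G"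
  \<comment> \<open>With \<beta> moved to the left, the claim becomes a lower bound on each member
    of the infimum. This also covers an infeasible \<open>U\<close>, whose value is
    \<infinity>.\<close>
  have "z_AR A B c d ?S / ereal \<beta> \<le> ar_cost c d U x y" if feas: "ar_feasible A B U x y" for x y
  proof -
    let ?y = "\<lambda>h. \<beta> *\<^sub>R y ((1 / \<beta>) *\<^sub>R h)"
    have cost: "ereal (c \<bullet> x + d \<bullet> y g) \<le> ar_cost c d U x y" if "g \<in> G" for g
      using ar_cost_le_iff[of U c d x y "ar_cost c d U x y"] that \<open>G \<subseteq> U\<close> by auto
    have "z_AR A B c d ?S \<le> ar_cost c d ?S (\<beta> *\<^sub>R x) ?y"
      unfolding z_AR_def using ar_feasible_scale[OF feas assms(1,2)]
      by (intro Inf_lower) blast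
    also have "\<dots> \<le> ereal \<beta> * ar_cost c d U x y"
    proof (subst ar_cost_le_iff)
      show "?S \<noteq> {}" using \<open>G \<noteq> {}\<close> by simp
      have "ereal (c \<bullet> (\<beta> *\<^sub>R x) + d \<bullet> (\<beta> *\<^sub>R y g)) \<le> ereal \<beta> * ar_cost c d U x y" if "g \<in> G" for g
      proof -
        have "ereal (c \<bullet> (\<beta> *\<^sub>R x) + d \<bullet> (\<beta> *\<^sub>R y g)) = ereal \<beta> * ereal (c \<bullet> x + d \<bullet> y g)"
          by (simp add: algebra_simps)
        also have "\<dots> \<le> ereal \<beta> * ar_cost c d U x y"
          using cost[OF that] \<open>\<beta> > 0\<close> by (intro ereal_mult_left_mono) auto
        finally show ?thesis .
      qed
      then show "\<forall>h\<in>?S. ereal (c \<bullet> (\<beta> *\<^sub>R x) + d \<bullet> ?y h) \<le> ereal \<beta> * ar_cost c d U x y"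
        using \<open>\<beta> > 0\<close> by auto
    qed
    finally show ?thesis
      using \<open>\<beta> > 0\<close> by (subst ereal_divide_le_pos) auto
  qed
  then have "z_AR A B c d ?S / ereal \<beta> \<le> z_AR A B c d U"
    unfolding z_AR_def[of A B c d U] by (intro Inf_greatest) auto
  then show ?thesis
    using \<open>\<beta> > 0\<close> by (subst (asm) ereal_divide_le_pos) auto
qed

lemma sum_excess_le_1:
  fixes v g :: "real^'m"
  assumes "0 \<le> v" and "g \<in> convex hull (range (\<lambda>i. axis i 1) \<union> {v})"
  shows "(\<Sum>i\<in>UNIV. max (g $ i - v $ i) 0) \<le> 1"
proof -
  let ?f = "\<lambda>g. \<Sum>i\<in>UNIV. max (g $ i - v $ i) 0"
  have v0: "0 \<le> v $ i" for i
    using assms(1) by (simp add: less_eq_vec_def)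
  have "convex {g. ?f g \<le> 1}"
  proof (rule convexI)
    fix a b :: "real^'m" and s t :: real
    assume ab: "a \<in> {g. ?f g \<le> 1}" "b \<in> {g. ?f g \<le> 1}" and st: "0 \<le> s" "0 \<le> t" "s + t = 1"
    have "max ((s *\<^sub>R a + t *\<^sub>R b) $ i - v $ i) 0
        \<le> s * max (a $ i - v $ i) 0 + t * max (b $ i - v $ i) 0" for i
    proof -
      have "(s *\<^sub>R a + t *\<^sub>R b) $ i - v $ i = s * (a $ i - v $ i) + t * (b $ i - v $ i)"
      proof -
        \<comment> \<open>Splitting \<open>v\<close> with the same weights turns the excess into a
          convex combination of excesses.\<close>
        have "v $ i = (s + t) * v $ i" using st by simp
        then show ?thesis by (simp add: algebra_simps)
      qed
      also have "\<dots> \<le> s * max (a $ i - v $ i) 0 + t * max (b $ i - v $ i) 0"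
        using st by (intro add_mono mult_left_mono) auto
      finally show ?thesis using st by simp
    qed
    then have "?f (s *\<^sub>R a + t *\<^sub>R b) \<le> s * ?f a + t * ?f b"
      unfolding sum_distrib_left sum.distrib[symmetric] by (rule sum_mono)
    also have "\<dots> \<le> s * 1 + t * 1"
      using ab st by (intro add_mono mult_left_mono) auto
    finally show "s *\<^sub>R a + t *\<^sub>R b \<in> {g. ?f g \<le> 1}"
      using st by simp
  qed
  moreover have "?f (axis i 1) \<le> 1" for i
  proof -
    \<comment> \<open>As \<open>0 \<le> v\<close>, only coordinate \<open>i\<close> can have
      positive excess, and that is at most 1.\<close>
    have "?f (axis i 1) \<le> (\<Sum>j\<in>UNIV. if j = i then 1 else 0)"
      using v0 by (intro sum_mono) (auto simp: axis_def)
    then show ?thesis by simp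
  qed
  ultimately have "convex hull (range (\<lambda>i. axis i 1) \<union> {v}) \<subseteq> {g. ?f g \<le> 1}"
    by (intro hull_minimal) auto
  then show ?thesis using assms(2) by auto
qed

text \<open>The positive part is monotone and positively homogeneous, so the bound for hull points
  passes to any \<open>h\<close> below \<open>\<beta> *\<^sub>R g\<close>.\<close>

lemma sum_excess_scaled_le:
  fixes v h :: "real^'m"
  assumes "\<beta> > 0" and "0 \<le> v"
    and "dominates ((\<lambda>h. \<beta> *\<^sub>R h) ` (convex hull (range (\<lambda>i. axis i 1) \<union> {v}))) U" and "h \<in> U"
  shows "(\<Sum>i\<in>UNIV. max (h $ i - \<beta> * v $ i) 0) \<le> \<beta>"
proof -
  obtain g where g: "g \<in> convex hull (range (\<lambda>i. axis i 1) \<union> {v})" and hg: "h \<le> \<beta> *\<^sub>R g"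
    using assms(3,4) unfolding dominates_def by blast
  have "max (h $ i - \<beta> * v $ i) 0 \<le> \<beta> * max (g $ i - v $ i) 0" for i
  proof -
    have "h $ i \<le> \<beta> * g $ i"
      using hg by (simp add: less_eq_vec_def)
    then have "h $ i - \<beta> * v $ i \<le> \<beta> * (g $ i - v $ i)"
      by (simp add: algebra_simps)
    also have "\<dots> \<le> \<beta> * max (g $ i - v $ i) 0"
      using \<open>\<beta> > 0\<close> by (intro mult_left_mono) auto
    finally show ?thesis using \<open>\<beta> > 0\<close> by simp
  qed
  then have "(\<Sum>i\<in>UNIV. max (h $ i - \<beta> * v $ i) 0) \<le> \<beta> * (\<Sum>i\<in>UNIV. max (g $ i - v $ i) 0)"
    unfolding sum_distrib_left by (rule sum_mono)
  also have "\<dots> \<le> \<beta> * 1"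
    using sum_excess_le_1[OF \<open>0 \<le> v\<close> g] \<open>\<beta> > 0\<close> by (intro mult_left_mono) auto
  finally show ?thesis by simp
qed

lemma matrix_vector_mult_nonneg:
  fixes A :: "real^'n^'m"
  assumes "0 \<le> A" and "0 \<le> x"
  shows "0 \<le> A *v x"
  using assms by (auto simp: less_eq_vec_def matrix_vector_mult_def intro!: sum_nonneg)

lemma inner_nonneg_vec:
  fixes c x :: "real^'n"
  assumes "0 \<le> c" and "0 \<le> x"
  shows "0 \<le> c \<bullet> x"
  using assms by (auto simp: less_eq_vec_def inner_vec_def intro!: sum_nonneg)

theorem theorem2p6:
  fixes A B :: "real^'n^'m"
    and c d xhat x :: "real^'n"
    and U Uhat :: "(real^'m) set"
    and \<beta> :: real
    and v :: "real^'m"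
    and yhat y :: "real^'m \<Rightarrow> real^'n"
  assumes "A \<ge> 0" and "c \<ge> 0" and "d \<ge> 0"
    and "assumption_1 U"
    and "\<beta> > 0" and "v \<in> U"
    and "Uhat = (\<lambda>h. \<beta> *\<^sub>R h) ` (convex hull (range (\<lambda>i. axis i 1) \<union> {v}))"
    and "dominates Uhat U"
    and "ar_optimal A B c d Uhat xhat yhat"
    and "x = 2 *\<^sub>R xhat"
    and "\<And>h. h \<in> U \<Longrightarrow>
           y h = (1 / \<beta>) *\<^sub>R (\<Sum>i\<in>UNIV. max (h $ i - \<beta> * v $ i) 0 *\<^sub>R yhat (\<beta> *\<^sub>R axis i 1))
                 + yhat (\<beta> *\<^sub>R v)"
  shows "ar_feasible A B U x y \<and> ar_approximation A B c d U (2 * \<beta>) x y"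
proof -
  define G where "G = convex hull (range (\<lambda>i. axis i 1) \<union> {v})"
  define E where "E i = \<beta> *\<^sub>R axis i (1::real)" for i :: 'm
  define w where "w h i = max (h $ i - \<beta> * v $ i) 0 / \<beta>" for h i
  note \<beta> = \<open>\<beta> > 0\<close>
  have Uhat: "Uhat = (\<lambda>h. \<beta> *\<^sub>R h) ` G"
    using assms(7) by (simp add: G_def)
  \<comment> \<open>All the generators lie in the convex set \<open>U\<close>.\<close>
  have "G \<subseteq> U"
    using assms(4,6) unfolding G_def assumption_1_def by (intro hull_minimal) auto
  have G: "axis i 1 \<in> G" "v \<in> G" for i
    unfolding G_def by (auto intro: hull_inc)
  have "0 \<le> v"
    using assms(4,6) unfolding assumption_1_def less_eq_vec_def by auto
  have EU: "E i \<in> Uhat" and vU: "\<beta> *\<^sub>R v \<in> Uhat" for i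
    using G by (auto simp: E_def Uhat)
  have feas: "ar_feasible A B Uhat xhat yhat"
    and opt: "ar_cost c d Uhat xhat yhat = z_AR A B c d Uhat"
    using assms(9) by (auto simp: ar_optimal_def)
  have xhat0: "0 \<le> xhat" and yhat0: "\<And>h. h \<in> Uhat \<Longrightarrow> 0 \<le> yhat h"
    and cover: "\<And>h. h \<in> Uhat \<Longrightarrow> h \<le> A *v xhat + B *v yhat h"
    using feas by (auto simp: ar_feasible_def)
  have w0: "0 \<le> w h i" for h i
    using \<beta> by (simp add: w_def)
  have w1: "(\<Sum>i\<in>UNIV. w h i) \<le> 1" if "h \<in> U" for h
    using sum_excess_scaled_le[OF \<beta> \<open>0 \<le> v\<close> _ that] assms(7,8) \<beta>
    by (simp add: w_def sum_divide_distrib[symmetric])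
  have y: "y h = (\<Sum>i\<in>UNIV. w h i *\<^sub>R yhat (E i)) + yhat (\<beta> *\<^sub>R v)" if "h \<in> U" for h
    using assms(11)[OF that] by (simp add: w_def E_def scaleR_sum_right)
  have y0: "0 \<le> y h" if "h \<in> U" for h
    unfolding y[OF that] using w0 yhat0 EU vU
    by (intro add_nonneg_nonneg sum_nonneg scaleR_nonneg_nonneg) auto
  have covU: "h \<le> A *v x + B *v y h" if h: "h \<in> U" for h
  proof -
    have Ax: "0 \<le> A *v xhat"
      using matrix_vector_mult_nonneg assms(1) xhat0 by blast
    \<comment> \<open>The weights are chosen so that the sum has coordinates
      \<open>max (h $ j - \<beta> * v $ j) 0\<close>, exactly what
      \<open>\<beta> *\<^sub>R v\<close> leaves uncovered.\<close>
    have "h \<le> (\<Sum>i\<in>UNIV. w h i *\<^sub>R E i) + \<beta> *\<^sub>R v"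
    proof -
      have "(\<Sum>i\<in>UNIV. w h i *\<^sub>R E i) $ j = max (h $ j - \<beta> * v $ j) 0" for j
        using \<beta> by (simp add: w_def E_def axis_def if_distrib sum.delta cong: if_cong)
      then show ?thesis
        by (auto simp: less_eq_vec_def)
    qed
    also have "\<dots> \<le> (\<Sum>i\<in>UNIV. w h i *\<^sub>R (A *v xhat + B *v yhat (E i)))
        + (A *v xhat + B *v yhat (\<beta> *\<^sub>R v))"
      using w0 EU vU by (intro add_mono sum_mono scaleR_left_mono cover) auto
    \<comment> \<open>Linearity of \<open>B\<close> reassembles \<open>y h\<close>, while the copies
      of \<open>A *v xhat\<close> collect the total weight. As \<open>A *v xhat\<close> is
      nonnegative, raising that weight to 1 next gives the factor 2 in \<open>x\<close>.\<close>
    also have "\<dots> = (\<Sum>i\<in>UNIV. w h i) *\<^sub>R (A *v xhat) + (A *v xhat + B *v y h)"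
      by (simp add: y[OF h] matrix_vector_right_distrib scaleR_add_right sum.distrib scaleR_sum_left
          matrix_vector_mult_scaleR linear_sum[OF matrix_vector_mul_linear])
    also have "\<dots> \<le> 1 *\<^sub>R (A *v xhat) + (A *v xhat + B *v y h)"
      using w1[OF h] Ax by (intro add_right_mono scaleR_right_mono)
    also have "\<dots> = A *v x + B *v y h"
      by (simp only: assms(10) scaleR_2 scaleR_one matrix_vector_right_distrib add.assoc)
    finally show ?thesis .
  qed
  have feasU: "ar_feasible A B U x y"
    using xhat0 y0 covU assms(10) by (auto simp: ar_feasible_def intro: scaleR_nonneg_nonneg)
  have "ereal (c \<bullet> x + d \<bullet> y h) \<le> ereal (2 * \<beta>) * z_AR A B c d U" if h: "h \<in> U" for h
  proof -
    let ?z = "z_AR A B c d Uhat"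
    have le_z: "ereal (c \<bullet> xhat + d \<bullet> yhat g) \<le> ?z" if "g \<in> Uhat" for g
      using ar_cost_le_iff[of Uhat c d xhat yhat ?z] that opt by auto
    have "?z < \<infinity>"
      using assms(9) by (simp add: ar_optimal_def)
    \<comment> \<open>Optimality excludes \<infinity>, and the cost at
      \<open>\<beta> *\<^sub>R v\<close> excludes -\<infinity>.\<close>
    then obtain r where r: "?z = ereal r"
      using le_z[OF vU] by (cases ?z) auto
    have le_r: "c \<bullet> xhat + d \<bullet> yhat g \<le> r" if "g \<in> Uhat" for g
      using le_z[OF that] r by simp
    have "0 \<le> c \<bullet> xhat" "0 \<le> d \<bullet> yhat (\<beta> *\<^sub>R v)"
      using inner_nonneg_vec assms(2,3) xhat0 yhat0[OF vU] by blast+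
    \<comment> \<open>This difference bounds every second-stage cost; its sign allows the total
      weight to be raised to 1 below.\<close>
    then have "0 \<le> r - c \<bullet> xhat"
      using le_r[OF vU] by simp
    have "d \<bullet> y h = (\<Sum>i\<in>UNIV. w h i * (d \<bullet> yhat (E i))) + d \<bullet> yhat (\<beta> *\<^sub>R v)"
      by (simp add: y[OF h] inner_add_right inner_sum_right)
    also have "\<dots> \<le> (\<Sum>i\<in>UNIV. w h i * (r - c \<bullet> xhat)) + (r - c \<bullet> xhat)"
      using w0 le_r EU vU
      by (intro add_mono sum_mono mult_left_mono) (auto simp: le_diff_eq add.commute)
    also have "\<dots> = (\<Sum>i\<in>UNIV. w h i) * (r - c \<bullet> xhat) + (r - c \<bullet> xhat)"
      by (simp add: sum_distrib_right)
    also have "\<dots> \<le> 1 * (r - c \<bullet> xhat) + (r - c \<bullet> xhat)"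
      using w1[OF h] \<open>0 \<le> r - c \<bullet> xhat\<close> by (intro add_right_mono mult_right_mono)
    \<comment> \<open>The first-stage cost \<open>2 * (c \<bullet> xhat)\<close> cancels against the
      two subtracted copies.\<close>
    finally have "c \<bullet> x + d \<bullet> y h \<le> 2 * r"
      using assms(10) by simp
    then have "ereal (c \<bullet> x + d \<bullet> y h) \<le> ereal 2 * ?z"
      by (simp add: r)
    also have "\<dots> \<le> ereal 2 * (ereal \<beta> * z_AR A B c d U)"
      unfolding Uhat using z_AR_scale_le[OF \<beta> \<open>G \<subseteq> U\<close>] G by (intro ereal_mult_left_mono) auto
    finally show ?thesis
      by (simp add: mult.assoc[symmetric])
  qed
  then show ?thesis
    using feasU by (simp add: ar_approximation_def)
qed

end
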